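(* Let $Y$ be a real vector space, $Q\subset Y\setminus\{0\}$ and $\emptyset\ne E\subset Y$, and let $\varphi^Q_E:Y\to\mathbb R\cup\{\pm\infty\}$ be the generalized nonconvex separation functional. Let $E$ satisfy $\lambda E\subset E$ for all $\lambda>0$. (a) Let $Q+E$ be a convex set. Then $\varphi^Q_E(y_1+y_2)\le\varphi^Q_E(y_1)+\varphi^Q_E(y_2)$ whenever $\varphi^Q_E(y_1)<0$ and $\varphi^Q_E(y_2)<0$. (b) Let $Q-E$ be a convex set. Then $\varphi^Q_E(y_1+y_2)\le\varphi^Q_E(y_1)+\varphi^Q_E(y_2)$ whenever $\varphi^Q_E(y_1)>0$ and $\varphi^Q_E(y_2)>0$.
   Context: For $A,B\subset Y$ and $\alpha\in\mathbb R$, $A\pm B=\{a\pm b:a\in A,b\in B\}$, $\alpha A=\{\alpha a:a\in A\}$, and $\mathbb R Q=\{tq:t\in\mathbb R,q\in Q\}$. The generalized nonconvex separation functional is defined by $\varphi^Q_E(y)=+\infty$ if $y\notin\mathbb R Q-E$, and $\varphi^Q_E(y)=\inf\{t\in\mathbb R: y\in tQ-E\}$ otherwise. *)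

theory Defs
  imports "HOL-Analysis.Analysis"
begin

text \<open>On sets, \<open>-\<close> is the set-theoretic difference, so the algebraic difference
  needs its own symbol; the algebraic sum is the instance of \<open>+\<close> from
  \<^theory>\<open>HOL-Library.Set_Algebras\<close>, and \<open>\<alpha>A\<close> is written \<open>(*\<^sub>R) \<alpha> ` A\<close>.\<close>

definition algebraic_diff :: "'a::minus set \<Rightarrow> 'a set \<Rightarrow> 'a set"  (infixl \<open>\<ominus>\<close> 65)
  where "A \<ominus> B = {c. \<exists>a\<in>A. \<exists>b\<in>B. c = a - b}"

definition real_multiples :: "'a::real_vector set \<Rightarrow> 'a set"
  where "real_multiples Q = {t *\<^sub>R q | t q. q \<in> Q}"

definition sep_functional :: "'a::real_vector set \<Rightarrow> 'a set \<Rightarrow> 'a \<Rightarrow> ereal"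
  where "sep_functional Q E y =
    (if y \<notin> real_multiples Q \<ominus> E then \<infinity>
     else INF t \<in> {t::real. y \<in> (*\<^sub>R) t ` Q \<ominus> E}. ereal t)"

end

theory Submission
  imports Defs
begin

text \<open>Call \<open>t\<close> a level of \<open>y\<close> if \<open>y \<in> tQ - E\<close>, so that the functional at \<open>y\<close> is the infimum of
  the levels of \<open>y\<close>. Subadditivity holds wherever levels can be added: if \<open>s\<close> and \<open>t\<close> being levels
  of \<open>y1\<close> and \<open>y2\<close> makes \<open>s + t\<close> a level of \<open>y1 + y2\<close>, then pass to infima.

  Since \<open>E\<close> is invariant under positive scaling, a nonzero factor can be pulled out of \<open>tQ - E\<close>:
  it equals \<open>t(Q - E)\<close> for \<open>t > 0\<close>, and \<open>t(Q + E)\<close> for \<open>t < 0\<close>, where the factor reverses the sign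
  of \<open>E\<close>. If the set \<open>C\<close> in parentheses is convex, then \<open>sC + tC \<subseteq> (s + t)C\<close> for \<open>s\<close> and \<open>t\<close> of equal
  sign, so levels of the corresponding sign can be added. The sign assumptions on the functional
  guarantee that levels of that sign are enough to compute the infimum: if the infimum is negative,
  there are negative levels arbitrarily close to it (or arbitrarily small); if it is positive, all
  levels are positive, and a point without levels makes the right-hand side \<open>\<infinity>\<close>.\<close>

text \<open>A point outside \<open>\<real>Q - E\<close> has no level, and the infimum of the empty set is \<open>\<infinity>\<close>.\<close>
lemma sep_functional_eq_INF:
  "sep_functional Q E y = (INF t \<in> {t. y \<in> (*\<^sub>R) t ` Q \<ominus> E}. ereal t)"
proof (cases "y \<in> real_multiples Q \<ominus> E")
  case True
  then show ?thesis by (simp add: sep_functional_def)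
next
  case False
  then have "{t. y \<in> (*\<^sub>R) t ` Q \<ominus> E} = {}"
    unfolding real_multiples_def algebraic_diff_def by blast
  then show ?thesis using False by (simp add: sep_functional_def top_ereal_def)
qed

lemma sep_functional_le:
  "y \<in> (*\<^sub>R) t ` Q \<ominus> E \<Longrightarrow> sep_functional Q E y \<le> ereal t"
  unfolding sep_functional_eq_INF by (rule INF_lower) simp

lemma sep_functional_less_iff:
  "sep_functional Q E y < a \<longleftrightarrow> (\<exists>t. y \<in> (*\<^sub>R) t ` Q \<ominus> E \<and> ereal t < a)"
  unfolding sep_functional_eq_INF by (auto simp: INF_less_iff)

lemma scaleR_image_diff_pos:
  fixes Q E :: "'a::real_vector set"
  assumes E: "\<forall>l::real. l > 0 \<longrightarrow> (*\<^sub>R) l ` E \<subseteq> E" and "t > 0"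
  shows "(*\<^sub>R) t ` Q \<ominus> E = (*\<^sub>R) t ` (Q \<ominus> E)"
proof (intro equalityI subsetI)
  fix y assume "y \<in> (*\<^sub>R) t ` Q \<ominus> E"
  then obtain q e where qe: "q \<in> Q" "e \<in> E" "y = t *\<^sub>R q - e"
    unfolding algebraic_diff_def by blast
  have "(1/t) *\<^sub>R e \<in> E" using E \<open>t > 0\<close> qe(2) by (meson image_subset_iff zero_less_divide_1_iff)
  moreover have "y = t *\<^sub>R (q - (1/t) *\<^sub>R e)" using \<open>t > 0\<close> qe(3) by (simp add: algebra_simps)
  ultimately show "y \<in> (*\<^sub>R) t ` (Q \<ominus> E)" using qe(1) unfolding algebraic_diff_def by blast
next
  fix y assume "y \<in> (*\<^sub>R) t ` (Q \<ominus> E)"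
  then obtain q e where qe: "q \<in> Q" "e \<in> E" "y = t *\<^sub>R (q - e)"
    unfolding algebraic_diff_def by blast
  have "t *\<^sub>R e \<in> E" using E \<open>t > 0\<close> qe(2) by blast
  moreover have "y = t *\<^sub>R q - t *\<^sub>R e" using qe(3) by (simp add: algebra_simps)
  ultimately show "y \<in> (*\<^sub>R) t ` Q \<ominus> E" using qe(1) unfolding algebraic_diff_def by blast
qed

text \<open>Negating \<open>t\<close> and \<open>Q\<close> at the same time leaves \<open>tQ\<close> unchanged, which reduces this to the case
  of a positive factor.\<close>
lemma scaleR_image_diff_neg:
  fixes Q E :: "'a::real_vector set"
  assumes E: "\<forall>l::real. l > 0 \<longrightarrow> (*\<^sub>R) l ` E \<subseteq> E" and "t < 0"
  shows "(*\<^sub>R) t ` Q \<ominus> E = (*\<^sub>R) t ` (Q + E)"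
proof -
  have "(*\<^sub>R) t ` Q \<ominus> E = (*\<^sub>R) (- t) ` (uminus ` Q) \<ominus> E"
    by (simp add: image_image)
  also have "\<dots> = (*\<^sub>R) (- t) ` (uminus ` Q \<ominus> E)"
    using \<open>t < 0\<close> by (intro scaleR_image_diff_pos[OF E]) simp
  also have "uminus ` Q \<ominus> E = uminus ` (Q + E)"
    unfolding algebraic_diff_def set_plus_def by force
  also have "(*\<^sub>R) (- t) ` uminus ` (Q + E) = (*\<^sub>R) t ` (Q + E)"
    by (simp add: image_image)
  finally show ?thesis .
qed

lemma convex_scaleR_image_add:
  fixes C :: "'a::real_vector set"
  assumes "convex C" and sign: "s > 0 \<and> t > 0 \<or> s < 0 \<and> t < 0"
    and "x \<in> (*\<^sub>R) s ` C" and "y \<in> (*\<^sub>R) t ` C"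
  shows "x + y \<in> (*\<^sub>R) (s + t) ` C"
proof -
  obtain a b where ab: "a \<in> C" "x = s *\<^sub>R a" "b \<in> C" "y = t *\<^sub>R b" using assms by blast
  have nz: "s + t \<noteq> 0" using sign by linarith
  have "s / (s + t) \<ge> 0" "t / (s + t) \<ge> 0" using sign by (auto simp: zero_le_divide_iff)
  moreover have "s / (s + t) + t / (s + t) = 1" using nz by (simp flip: add_divide_distrib)
  ultimately have "(s / (s + t)) *\<^sub>R a + (t / (s + t)) *\<^sub>R b \<in> C"
    using \<open>convex C\<close> ab by (blast intro: convexD)
  moreover have "x + y = (s + t) *\<^sub>R ((s / (s + t)) *\<^sub>R a + (t / (s + t)) *\<^sub>R b)"
    using nz ab by (simp add: scaleR_add_right)
  ultimately show ?thesis by blast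
qed

text \<open>Quantifying over real bounds of the summands, instead of approximating them up to an error
  \<open>\<epsilon>\<close>, also covers a summand \<open>-\<infinity>\<close>: the bound on that summand can absorb whatever is left of a
  bound \<open>c\<close> on the sum. The premises \<open>x < \<infinity>\<close> and \<open>y < \<infinity>\<close> ensure that real upper bounds exist.\<close>
lemma ereal_le_add_of_real_bounds:
  fixes x y z :: ereal
  assumes "x < \<infinity>" "y < \<infinity>"
    and le: "\<And>a b::real. x < ereal a \<Longrightarrow> y < ereal b \<Longrightarrow> z \<le> ereal (a + b)"
  shows "z \<le> x + y"
proof (rule ereal_le_real)
  fix c :: real assume c: "x + y \<le> ereal c"
  obtain a b where a: "x \<le> ereal a" and b: "y \<le> ereal b" and ab: "a + b \<le> c"
  proof (cases x)
    case (real r)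
    note x = this
    show thesis
    proof (cases y)
      case (real r')
      then show thesis using x c by (intro that[of r r']) auto
    next
      case MInf
      then show thesis using x by (intro that[of r "c - r"]) auto
    qed (use \<open>y < \<infinity>\<close> in auto)
  next
    case MInf
    obtain b where "y \<le> ereal b" using \<open>y < \<infinity>\<close> by (cases y) auto
    then show thesis using MInf by (intro that[of "c - b" b]) auto
  qed (use \<open>x < \<infinity>\<close> in auto)
  show "z \<le> ereal c"
  proof (rule ereal_le_epsilon2)
    fix e :: real assume "e > 0"
    then have "x < ereal (a + e/2)" "y < ereal (b + e/2)"
      using a b by (auto elim!: le_less_trans)
    from le[OF this] have "z \<le> ereal (a + b + e)" by (simp add: algebra_simps)
    also have "\<dots> \<le> ereal c + ereal e" using ab by simp
    finally show "z \<le> ereal c + ereal e" .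
  qed
qed

text \<open>The passage from levels to infima: only levels in a set \<open>T\<close> have to be additive, as long as
  the levels in \<open>T\<close> come below every real number above the functional. In the application \<open>T\<close>
  consists of the numbers of one sign.\<close>
lemma sep_functional_add_le:
  fixes Q E :: "'a::real_vector set" and T :: "real set"
  assumes fin: "sep_functional Q E y1 < \<infinity>" "sep_functional Q E y2 < \<infinity>"
    and dense: "\<And>y a. y \<in> {y1, y2} \<Longrightarrow> sep_functional Q E y < ereal a \<Longrightarrow>
          \<exists>t\<in>T. y \<in> (*\<^sub>R) t ` Q \<ominus> E \<and> t < a"
    and add: "\<And>s t. s \<in> T \<Longrightarrow> t \<in> T \<Longrightarrow> y1 \<in> (*\<^sub>R) s ` Q \<ominus> E \<Longrightarrow> y2 \<in> (*\<^sub>R) t ` Q \<ominus> E \<Longrightarrow>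
          y1 + y2 \<in> (*\<^sub>R) (s + t) ` Q \<ominus> E"
  shows "sep_functional Q E (y1 + y2) \<le> sep_functional Q E y1 + sep_functional Q E y2"
proof (rule ereal_le_add_of_real_bounds[OF fin])
  fix a b :: real
  assume "sep_functional Q E y1 < ereal a" "sep_functional Q E y2 < ereal b"
  then obtain s t where st: "s \<in> T" "y1 \<in> (*\<^sub>R) s ` Q \<ominus> E" "s < a"
      "t \<in> T" "y2 \<in> (*\<^sub>R) t ` Q \<ominus> E" "t < b"
    using dense by blast
  then have "sep_functional Q E (y1 + y2) \<le> ereal (s + t)" by (intro sep_functional_le add)
  also have "\<dots> \<le> ereal (a + b)" using st by simp
  finally show "sep_functional Q E (y1 + y2) \<le> ereal (a + b)" .
qed

theorem proposition4p4:
  fixes Q E :: "'a::real_vector set"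
  assumes "Q \<subseteq> UNIV - {0}"
    and "E \<noteq> {}"
    and "\<forall>l::real. l > 0 \<longrightarrow> (*\<^sub>R) l ` E \<subseteq> E"
  shows "(convex (Q + E) \<longrightarrow>
           (\<forall>y1 y2. sep_functional Q E y1 < 0 \<and> sep_functional Q E y2 < 0 \<longrightarrow>
             sep_functional Q E (y1 + y2) \<le> sep_functional Q E y1 + sep_functional Q E y2)) \<and>
         (convex (Q \<ominus> E) \<longrightarrow>
           (\<forall>y1 y2. sep_functional Q E y1 > 0 \<and> sep_functional Q E y2 > 0 \<longrightarrow>
             sep_functional Q E (y1 + y2) \<le> sep_functional Q E y1 + sep_functional Q E y2))"
proof (intro conjI impI allI; elim conjE)
  fix y1 y2
  assume conv: "convex (Q + E)"
    and neg: "sep_functional Q E y1 < 0" "sep_functional Q E y2 < 0"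
  show "sep_functional Q E (y1 + y2) \<le> sep_functional Q E y1 + sep_functional Q E y2"
  proof (rule sep_functional_add_le[where T = "{..<0}"])
    show "sep_functional Q E y1 < \<infinity>" "sep_functional Q E y2 < \<infinity>" using neg by auto
  next
    fix y and a :: real assume "y \<in> {y1, y2}" "sep_functional Q E y < ereal a"
    then have "sep_functional Q E y < min (ereal a) 0" using neg by auto
    then show "\<exists>t\<in>{..<0}. y \<in> (*\<^sub>R) t ` Q \<ominus> E \<and> t < a"
      unfolding sep_functional_less_iff by auto
  next
    fix s t :: real
    assume "s \<in> {..<0}" "t \<in> {..<0}" "y1 \<in> (*\<^sub>R) s ` Q \<ominus> E" "y2 \<in> (*\<^sub>R) t ` Q \<ominus> E"
    then show "y1 + y2 \<in> (*\<^sub>R) (s + t) ` Q \<ominus> E"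
      using convex_scaleR_image_add[OF conv, of s t y1 y2]
      by (simp add: scaleR_image_diff_neg[OF assms(3)])
  qed
next
  fix y1 y2
  assume conv: "convex (Q \<ominus> E)"
    and pos: "sep_functional Q E y1 > 0" "sep_functional Q E y2 > 0"
  show "sep_functional Q E (y1 + y2) \<le> sep_functional Q E y1 + sep_functional Q E y2"
  proof (cases "sep_functional Q E y1 = \<infinity> \<or> sep_functional Q E y2 = \<infinity>")
    case True
    then show ?thesis by auto
  next
    case False
    show ?thesis
    proof (rule sep_functional_add_le[where T = "{0<..}"])
      show "sep_functional Q E y1 < \<infinity>" "sep_functional Q E y2 < \<infinity>" using False by auto
    next
      fix y and a :: real assume y: "y \<in> {y1, y2}" "sep_functional Q E y < ereal a"
      then obtain t where t: "y \<in> (*\<^sub>R) t ` Q \<ominus> E" "t < a"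
        unfolding sep_functional_less_iff by auto
      have "0 < sep_functional Q E y" using y pos by auto
      also have "\<dots> \<le> ereal t" by (rule sep_functional_le[OF t(1)])
      finally show "\<exists>t\<in>{0<..}. y \<in> (*\<^sub>R) t ` Q \<ominus> E \<and> t < a" using t by auto
    next
      fix s t :: real
      assume "s \<in> {0<..}" "t \<in> {0<..}" "y1 \<in> (*\<^sub>R) s ` Q \<ominus> E" "y2 \<in> (*\<^sub>R) t ` Q \<ominus> E"
      then show "y1 + y2 \<in> (*\<^sub>R) (s + t) ` Q \<ominus> E"
        using convex_scaleR_image_add[OF conv, of s t y1 y2]
        by (simp add: scaleR_image_diff_pos[OF assms(3)])
    qed
  qed
qed

end
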